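(* Let $\mathcal B$ be a separable complex Banach space, $U\subset\mathbb C$ open and connected, $A:U\to\mathcal L_{\mathcal B}$ a holomorphic Fredholm operator pencil, and $z_0\in\sigma(A)$ an isolated element of $\sigma(A)$. Let $A(z)=\sum_{j\ge 0}A_j(z-z_0)^j$ be the Taylor series of $A$ around $z_0$ and let $$A(z)^{-1}=\sum_{j=-m}^{\infty}N_j(z-z_0)^j,\qquad 1\le m<\infty,\ N_{-m}\neq 0,$$ be the Laurent series of the inverse in a punctured neighborhood of $z_0$. Put $\mathrm R_0=\operatorname{ran}A_0$ and $\mathrm K_0=\ker A_0$. Then the following conditions are equivalent: (i) $m=1$. (ii) $\mathcal B=\mathrm R_0\oplus A_1\mathrm K_0$. (iii) For all possible choices of a complementary subspace $\mathrm R_0^c$ of $\mathrm R_0$, the map $S_{\mathrm R_0^c}=\mathrm P_{\mathrm R_0^c}A_1|_{\mathrm K_0}:\mathrm K_0\to\mathrm R_0^c$ is invertible. (iv) For some choice of a complementary subspace $\mathrm R_0^c$ of $\mathrm R_0$, the map $S_{\mathrm R_0^c}:\mathrm K_0\to\mathrm R_0^c$ is invertible. Moreover, under any of these conditions and for any choice of complementary subspaces $\mathrm R_0^c$ of $\mathrm R_0$ and $\mathrm K_0^c$ of $\mathrm K_0$, the coefficients $(N_j,\ j\ge -1)$ are given by the recursive formula $$N_{-1}=S_{\mathrm R_0^c}^{-1}\mathrm P_{\mathrm R_0^c},$$ and, for $j\ge 0$, $$N_j=\big(\mathbf 1_{j=0}-G_j(0,1)\big)(A_0)^g_{\{\mathrm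 R_0^c,\mathrm K_0^c\}}\big(\mathrm{id}_{\mathcal B}-A_1S_{\mathrm R_0^c}^{-1}\mathrm P_{\mathrm R_0^c}\big)-G_j(1,1)S_{\mathrm R_0^c}^{-1}\mathrm P_{\mathrm R_0^c},$$ where each $N_j$ is understood as a map from $\mathcal B$ to $\mathcal B$.
   Context: $\mathcal L_{\mathcal B}$ is the Banach space of bounded linear operators on $\mathcal B$ with the operator norm. An operator $T\in\mathcal L_{\mathcal B}$ is Fredholm if $\ker T$ and $\mathcal B/\operatorname{ran}T$ are finite dimensional. A holomorphic Fredholm operator pencil on $U$ is a map $A:U\to\mathcal L_{\mathcal B}$, holomorphic in the operator norm topology, with $A(z)$ Fredholm for every $z\in U$. Its spectrum is $\sigma(A)=\{z\in U: A(z)\text{ is not invertible}\}$. By the analytic Fredholm theorem, $A(z)^{-1}$ exists in a punctured neighborhood of $z_0$ and has a pole of some finite order $m\ge1$ at $z_0$. Direct sums: $\mathcal B=V\oplus W$ means $V,W$ are closed subspaces with $V\cap W=\{0\}$ and $V+W=\mathcal B$; then $W$ is called a complementary subspace of $V$, denoted $V^c$ (not unique in general), and $\mathrm P_{V^c}$ denotes the bounded projection onto $V^c$ along $V$. Under the present hypotheses $\mathrm R_0$ and $\mathrm K_0$ admit complementary subspaces. Given complementary subspaces $\mathrm R_0^c$ of $\mathrm R_0=\operatorname{ran}A_0$ and $\mathrm K_0^c$ of $\mathrm K_0=\ker A_0$, the generalized inverse of $A_0$ is $(A_0)^g_{\{\mathrm R_0^c,\mathrm K_0^c\}}=(A_0|_{\mathrm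 K_0^c})^{-1}(\mathrm{id}_{\mathcal B}-\mathrm P_{\mathrm R_0^c})$, where $(A_0|_{\mathrm K_0^c})^{-1}$ is defined on $\mathrm R_0$. Notation: $\mathbf 1_{j=0}=\mathrm{id}_{\mathcal B}$ if $j=0$ and $\mathbf 1_{j=0}=0$ otherwise; $G_j(\ell,m)=\sum_{k=-m}^{j-1}N_kA_{j+\ell-k}$ for $\ell=0,1,2,\ldots$. *)

theory Defs
  imports "HOL-Analysis.Analysis"
begin

section \<open>Complex Banach spaces\<close>

class complex_vector = real_vector +
  fixes scaleC :: "complex \<Rightarrow> 'a \<Rightarrow> 'a"  (infixr \<open>*\<^sub>C\<close> 75)
  assumes scaleC_add_right: "c *\<^sub>C (x + y) = c *\<^sub>C x + c *\<^sub>C y"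
    and scaleC_add_left: "(c + d) *\<^sub>C x = c *\<^sub>C x + d *\<^sub>C x"
    and scaleC_scaleC: "c *\<^sub>C d *\<^sub>C x = (c * d) *\<^sub>C x"
    and scaleC_one: "1 *\<^sub>C x = x"
    and scaleR_scaleC: "r *\<^sub>R x = complex_of_real r *\<^sub>C x"

class complex_normed_vector = complex_vector + real_normed_vector +
  assumes norm_scaleC: "norm (c *\<^sub>C x) = cmod c * norm x"

class complex_banach = complex_normed_vector + banach

global_interpretation complex_vector: vector_space "scaleC :: complex \<Rightarrow> 'a \<Rightarrow> 'a::complex_vector"
  by unfold_locales (simp_all add: scaleC_add_right scaleC_add_left scaleC_scaleC scaleC_one)

definition finite_dim_subspace :: "'a::complex_vector set \<Rightarrow> bool" where
  "finite_dim_subspace V \<longleftrightarrow> (\<exists>F. finite F \<and> complex_vector.span F = V)"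

text \<open>The quotient by \<open>V\<close> is finite dimensional: the cosets of finitely many vectors span it.\<close>

definition finite_dim_quotient :: "'a::complex_vector set \<Rightarrow> bool" where
  "finite_dim_quotient V \<longleftrightarrow>
     (\<exists>F. finite F \<and> (\<forall>x. \<exists>y\<in>complex_vector.span F. x - y \<in> V))"


section \<open>Bounded complex-linear operators\<close>

text \<open>
  \<^typ>\<open>'a \<Rightarrow>\<^sub>L 'b\<close> consists of the bounded \<^emph>\<open>real\<close>-linear maps. When the codomain is a complex space it
  is a complex normed space, and the bounded complex-linear maps form the
  complex subspace \<open>cblinear\<close> below, whose norm is the operator norm.
\<close>

lemma bounded_linear_scaleC: "bounded_linear ((*\<^sub>C) c :: 'a::complex_normed_vector \<Rightarrow> 'a)"
proof (rule bounded_linear_intro)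
  show "c *\<^sub>C (x + y) = c *\<^sub>C x + c *\<^sub>C y" for x y :: 'a
    by (rule scaleC_add_right)
  show "c *\<^sub>C (r *\<^sub>R x) = r *\<^sub>R (c *\<^sub>C x)" for r and x :: 'a
    by (simp add: scaleR_scaleC scaleC_scaleC mult.commute)
  show "norm (c *\<^sub>C x) \<le> norm x * cmod c" for x :: 'a
    by (simp add: norm_scaleC mult.commute)
qed

instantiation blinfun :: (real_normed_vector, complex_normed_vector) complex_normed_vector
begin

lift_definition scaleC_blinfun :: "complex \<Rightarrow> 'a \<Rightarrow>\<^sub>L 'b \<Rightarrow> 'a \<Rightarrow>\<^sub>L 'b" is "\<lambda>c f x. c *\<^sub>C f x"
  by (rule bounded_linear_compose[OF bounded_linear_scaleC])

instance
proof
  have le: "norm (c *\<^sub>C f) \<le> cmod c * norm f" for c and f :: "'a \<Rightarrow>\<^sub>L 'b"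
  proof (rule norm_blinfun_bound)
    show "norm (blinfun_apply (c *\<^sub>C f) x) \<le> cmod c * norm f * norm x" for x
      using mult_left_mono[OF norm_blinfun[of f x], of "cmod c"]
      by (simp add: scaleC_blinfun.rep_eq norm_scaleC mult.assoc)
  qed simp
  fix c d :: complex and r :: real and f g :: "'a \<Rightarrow>\<^sub>L 'b"
  show "c *\<^sub>C (f + g) = c *\<^sub>C f + c *\<^sub>C g"
    by transfer (simp add: scaleC_add_right)
  show "(c + d) *\<^sub>C f = c *\<^sub>C f + d *\<^sub>C f"
    by transfer (simp add: scaleC_add_left)
  show assoc: "c *\<^sub>C d *\<^sub>C f = (c * d) *\<^sub>C f" for c d
    by transfer (simp add: scaleC_scaleC)
  show one: "1 *\<^sub>C f = f"
    by transfer (simp add: scaleC_one)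
  show "r *\<^sub>R f = complex_of_real r *\<^sub>C f"
    by transfer (simp add: scaleR_scaleC)
  show "norm (c *\<^sub>C f) = cmod c * norm f"
  proof (cases "c = 0")
    case True
    then show ?thesis using le[of 0 f] by simp
  next
    case False
    have "norm f = norm (inverse c *\<^sub>C c *\<^sub>C f)"
      using False by (simp add: assoc one)
    also have "\<dots> \<le> inverse (cmod c) * norm (c *\<^sub>C f)"
      using le[of "inverse c" "c *\<^sub>C f"] by (simp add: norm_inverse)
    finally have "cmod c * norm f \<le> norm (c *\<^sub>C f)"
      using False by (simp add: field_simps)
    with le[of c f] show ?thesis by simp
  qed
qed

end

instance blinfun :: (real_normed_vector, complex_banach) complex_banach ..

definition cblinear :: "('a::complex_normed_vector \<Rightarrow>\<^sub>L 'a) set" where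
  "cblinear = {T. \<forall>c x. blinfun_apply T (c *\<^sub>C x) = c *\<^sub>C blinfun_apply T x}"

definition op_ker :: "('a::real_normed_vector \<Rightarrow>\<^sub>L 'b::real_normed_vector) \<Rightarrow> 'a set" where
  "op_ker T = {x. blinfun_apply T x = 0}"

definition op_ran :: "('a::real_normed_vector \<Rightarrow>\<^sub>L 'b::real_normed_vector) \<Rightarrow> 'b set" where
  "op_ran T = range (blinfun_apply T)"

definition fredholm :: "('a::complex_normed_vector \<Rightarrow>\<^sub>L 'a) \<Rightarrow> bool" where
  "fredholm T \<longleftrightarrow> T \<in> cblinear \<and> finite_dim_subspace (op_ker T) \<and> finite_dim_quotient (op_ran T)"

definition op_invertible :: "('a::complex_normed_vector \<Rightarrow>\<^sub>L 'a) \<Rightarrow> bool" where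
  "op_invertible T \<longleftrightarrow> (\<exists>S\<in>cblinear. S o\<^sub>L T = id_blinfun \<and> T o\<^sub>L S = id_blinfun)"

definition op_inverse :: "('a::complex_normed_vector \<Rightarrow>\<^sub>L 'a) \<Rightarrow> 'a \<Rightarrow>\<^sub>L 'a" where
  "op_inverse T = (THE S. S \<in> cblinear \<and> S o\<^sub>L T = id_blinfun \<and> T o\<^sub>L S = id_blinfun)"


section \<open>Holomorphic Fredholm pencils\<close>

text \<open>Complex differentiability in norm: the real derivative is \<open>h \<mapsto> h D\<close> for a vector \<open>D\<close>.\<close>

definition vec_holomorphic_on :: "(complex \<Rightarrow> 'b::complex_normed_vector) \<Rightarrow> complex set \<Rightarrow> bool"
    where
  "vec_holomorphic_on f U \<longleftrightarrow>
     (\<forall>z\<in>U. \<exists>D. (f has_derivative (\<lambda>h. h *\<^sub>C D)) (at z within U))"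

definition fredholm_pencil ::
    "(complex \<Rightarrow> 'a::complex_normed_vector \<Rightarrow>\<^sub>L 'a) \<Rightarrow> complex set \<Rightarrow> bool" where
  "fredholm_pencil A U \<longleftrightarrow> vec_holomorphic_on A U \<and> (\<forall>z\<in>U. fredholm (A z))"

definition pencil_spectrum ::
    "(complex \<Rightarrow> 'a::complex_normed_vector \<Rightarrow>\<^sub>L 'a) \<Rightarrow> complex set \<Rightarrow> complex set" where
  "pencil_spectrum A U = {z \<in> U. \<not> op_invertible (A z)}"

definition has_taylor_series ::
    "(complex \<Rightarrow> 'b::complex_normed_vector) \<Rightarrow> (nat \<Rightarrow> 'b) \<Rightarrow> complex \<Rightarrow> bool" where
  "has_taylor_series f a z0 \<longleftrightarrow> (\<forall>\<^sub>F z in nhds z0. (\<lambda>j. (z - z0) ^ j *\<^sub>C a j) sums f z)"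

text \<open>
  Laurent series with finite principal part starting at \<open>-m\<close>; the values \<open>N j\<close> with \<open>j < -m\<close> play no role.
\<close>

definition has_laurent_series ::
    "(complex \<Rightarrow> 'b::complex_normed_vector) \<Rightarrow> (int \<Rightarrow> 'b) \<Rightarrow> nat \<Rightarrow> complex \<Rightarrow> bool" where
  "has_laurent_series f N m z0 \<longleftrightarrow>
     (\<forall>\<^sub>F z in at z0.
        (\<lambda>k. (z - z0) powi (int k - int m) *\<^sub>C N (int k - int m)) sums f z)"


section \<open>Direct sums, projections and generalized inverses\<close>

definition direct_sum :: "'a::complex_normed_vector set \<Rightarrow> 'a set \<Rightarrow> bool" where
  "direct_sum V W \<longleftrightarrow>
     complex_vector.subspace V \<and> closed V \<and> complex_vector.subspace W \<and> closed W \<and>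
     V \<inter> W = {0} \<and> {v + w | v w. v \<in> V \<and> w \<in> W} = UNIV"

text \<open>
  \<open>proj_onto W V\<close> is the projection onto \<open>W\<close> along \<open>V\<close>, meaningful when \<open>direct_sum V W\<close> holds;
  on a Banach space it is then automatically bounded, both summands being closed.
\<close>

definition proj_onto :: "'a::complex_normed_vector set \<Rightarrow> 'a set \<Rightarrow> 'a \<Rightarrow> 'a" where
  "proj_onto W V x = (THE w. w \<in> W \<and> x - w \<in> V)"

text \<open>Invertibility of an operator between subspaces, with bounded linear inverse.\<close>

definition invertible_between ::
    "'a::complex_normed_vector set \<Rightarrow> 'a set \<Rightarrow> ('a \<Rightarrow> 'a) \<Rightarrow> bool" where
  "invertible_between V W f \<longleftrightarrow>
     f ` V \<subseteq> W \<and>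
     (\<exists>g. g ` W \<subseteq> V \<and> (\<forall>v\<in>V. g (f v) = v) \<and> (\<forall>w\<in>W. f (g w) = w) \<and>
        (\<forall>x\<in>W. \<forall>y\<in>W. g (x + y) = g x + g y) \<and> (\<forall>c. \<forall>x\<in>W. g (c *\<^sub>C x) = c *\<^sub>C g x) \<and>
        (\<exists>K. \<forall>x\<in>W. norm (g x) \<le> K * norm x))"

text \<open>\<open>Rc\<close> and \<open>Kc\<close> are complementary subspaces of the range and the kernel of \<open>T\<close>.\<close>

definition gen_inverse ::
    "('a::complex_normed_vector \<Rightarrow>\<^sub>L 'a) \<Rightarrow> 'a set \<Rightarrow> 'a set \<Rightarrow> 'a \<Rightarrow> 'a" where
  "gen_inverse T Rc Kc x = the_inv_into Kc (blinfun_apply T) (x - proj_onto Rc (op_ran T) x)"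

text \<open>
  \<open>a\<close> is the sequence of Taylor coefficients of a pencil. Only the restriction of \<open>S_map a Rc\<close> to the
  kernel of \<open>a 0\<close> matters, and \<open>S_inv a Rc\<close> is its inverse, defined on \<open>Rc\<close>.
\<close>

definition S_map :: "(nat \<Rightarrow> 'a::complex_normed_vector \<Rightarrow>\<^sub>L 'a) \<Rightarrow> 'a set \<Rightarrow> 'a \<Rightarrow> 'a" where
  "S_map a Rc x = proj_onto Rc (op_ran (a 0)) (blinfun_apply (a 1) x)"

definition S_inv :: "(nat \<Rightarrow> 'a::complex_normed_vector \<Rightarrow>\<^sub>L 'a) \<Rightarrow> 'a set \<Rightarrow> 'a \<Rightarrow> 'a" where
  "S_inv a Rc = the_inv_into (op_ker (a 0)) (S_map a Rc)"

text \<open>The index \<open>j + l - k\<close> is positive for every \<open>k\<close> in the range of summation.\<close>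

definition G_sum ::
    "(nat \<Rightarrow> 'a::complex_normed_vector \<Rightarrow>\<^sub>L 'a) \<Rightarrow> (int \<Rightarrow> 'a \<Rightarrow>\<^sub>L 'a) \<Rightarrow>
     nat \<Rightarrow> nat \<Rightarrow> nat \<Rightarrow> 'a \<Rightarrow>\<^sub>L 'a" where
  "G_sum a N j l m = (\<Sum>k\<in>{- int m..int j - 1}. N k o\<^sub>L a (nat (int j + int l - k)))"

end

theory Submission
  imports Defs
begin

text \<open>
  Comparing coefficients in \<open>A(z)\<^sup>-\<^sup>1 A(z) = id = A(z) A(z)\<^sup>-\<^sup>1\<close> yields two families of convolution
  identities between the \<open>A\<^sub>j\<close> and the \<open>N\<^sub>j\<close>, and everything else is algebra. If \<open>m \<ge> 2\<close>, the left
  identities of orders \<open>-m\<close> and \<open>1 - m\<close> show that \<open>N\<^bsub>-m\<^esub>\<close> vanishes on both \<open>R\<^sub>0\<close> and \<open>A\<^sub>1 K\<^sub>0\<close>, so these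
  cannot span. If \<open>m = 1\<close>, then \<open>id = A\<^sub>0 N\<^sub>0 + A\<^sub>1 N\<^bsub>-1\<^esub>\<close> with \<open>N\<^bsub>-1\<^esub>\<close> mapping into \<open>K\<^sub>0\<close> and inverting \<open>A\<^sub>1\<close>
  there, so that \<open>N\<^bsub>-1\<^esub>\<close> restricted to any complement of \<open>R\<^sub>0\<close> is the inverse of \<open>S\<close>; evaluating the left
  identities on \<open>A\<^sub>0 u + A\<^sub>1 k\<close> gives the recursion. That (iii) is not vacuous needs \<open>R\<^sub>0\<close> to be closed;
  this holds because the principal part of the inverse has finite rank.
\<close>

section \<open>Finite-dimensional subspaces\<close>

lemma tendsto_scaleC [tendsto_intros]:
  fixes c :: "'b \<Rightarrow> complex" and f :: "'b \<Rightarrow> 'a::complex_normed_vector"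
  assumes c: "(c \<longlongrightarrow> k) F" and f: "(f \<longlongrightarrow> x) F"
  shows "((\<lambda>z. c z *\<^sub>C f z) \<longlongrightarrow> k *\<^sub>C x) F"
proof (rule bounded_bilinear.tendsto[OF _ c f])
  show "bounded_bilinear ((*\<^sub>C) :: complex \<Rightarrow> 'a \<Rightarrow> 'a)"
    by unfold_locales
      (auto simp: scaleC_add_left scaleC_add_right scaleR_scaleC scaleC_scaleC norm_scaleC
        scaleR_conv_of_real mult.commute intro!: exI[of _ 1])
qed

text \<open>If \<open>x\<close> lies outside \<open>V\<close>, its distance \<open>d\<close> from
  \<open>V\<close> is positive and controls the coefficient by
  \<open>cmod k * d \<le> norm y\<close>, so the coefficients along a convergent sequence form a
  Cauchy sequence. The set has the shape that \<open>span_insert\<close> produces, ready for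
  induction on generators.\<close>

lemma closed_subspace_insert:
  fixes V :: "'a::complex_normed_vector set" and x :: 'a
  assumes V: "complex_vector.subspace V" and cl: "closed V"
  shows "closed {y. \<exists>k. y - k *\<^sub>C x \<in> V}"
proof (cases "x \<in> V")
  case True
  have "y \<in> V" if "y - k *\<^sub>C x \<in> V" for y k
    using complex_vector.subspace_add[OF V that complex_vector.subspace_scale[OF V True, of k]]
    by simp
  then have "{y. \<exists>k. y - k *\<^sub>C x \<in> V} = V"
    by (auto intro: exI[of _ 0])
  with cl show ?thesis by simp
next
  case False
  define d where "d = infdist x V"
  have "V \<noteq> {}"
    using complex_vector.subspace_0[OF V] by auto
  then have d: "d > 0"
    unfolding d_def by (rule infdist_pos_not_in_closed[OF cl _ False])
  have low: "cmod k * d \<le> norm y" if "y - k *\<^sub>C x \<in> V" for y k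
  proof (cases "k = 0")
    case False
    let ?v = "- inverse k *\<^sub>C (y - k *\<^sub>C x)"
    have "?v \<in> V"
      by (rule complex_vector.subspace_scale[OF V that])
    then have "d \<le> dist x ?v"
      unfolding d_def by (rule infdist_le)
    also have "x - ?v = inverse k *\<^sub>C y"
      using False by (simp add: complex_vector.scale_right_diff_distrib scaleC_scaleC scaleC_one)
    then have "dist x ?v = norm y / cmod k"
      by (simp add: dist_norm norm_scaleC norm_inverse divide_inverse mult.commute)
    finally show ?thesis
      using False by (simp add: field_simps)
  qed simp
  show ?thesis
    unfolding closed_sequential_limits
  proof (intro allI impI, elim conjE)
    fix s y
    assume "\<forall>n. s n \<in> {y. \<exists>k. y - k *\<^sub>C x \<in> V}" and lim: "s \<longlonglongrightarrow> y"
    then obtain t where t: "\<And>n. s n - t n *\<^sub>C x \<in> V"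
      by (auto simp: choice_iff)
    \<comment> \<open>The bound \<open>low\<close> for \<open>s i - s j\<close>, whose coefficient
      of \<open>x\<close> is \<open>t i - t j\<close>.\<close>
    have "dist (t i) (t j) * d \<le> dist (s i) (s j)" for i j
      unfolding dist_norm
      by (rule low)
        (use complex_vector.subspace_diff[OF V t[of i] t[of j]]
          in \<open>simp add: complex_vector.scale_left_diff_distrib algebra_simps\<close>)
    then have le: "dist (t i) (t j) \<le> dist (s i) (s j) / d" for i j
      using d by (simp add: field_simps)
    have "Cauchy t"
    proof (rule metric_CauchyI)
      fix e :: real assume "e > 0"
      with d obtain M where "\<forall>i\<ge>M. \<forall>j\<ge>M. dist (s i) (s j) < e * d"
        using metric_CauchyD[OF LIMSEQ_imp_Cauchy[OF lim], of "e * d"] by auto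
      then have "\<forall>i\<ge>M. \<forall>j\<ge>M. dist (s i) (s j) / d < e"
        using d by (simp add: field_simps)
      with le show "\<exists>M. \<forall>i\<ge>M. \<forall>j\<ge>M. dist (t i) (t j) < e"
        by (meson le_less_trans)
    qed
    then obtain k where k: "t \<longlonglongrightarrow> k"
      by (auto simp: Cauchy_convergent_iff convergent_def)
    have "(\<lambda>n. s n - t n *\<^sub>C x) \<longlonglongrightarrow> y - k *\<^sub>C x"
      by (intro tendsto_intros lim k)
    from closed_sequentially[OF cl t this] show "y \<in> {y. \<exists>k. y - k *\<^sub>C x \<in> V}" by auto
  qed
qed

lemma closed_span_finite:
  fixes F :: "'a::complex_normed_vector set"
  assumes "finite F"
  shows "closed (complex_vector.span F)"
  using assms
  by (induction F)
    (simp_all add: complex_vector.span_insert closed_subspace_insert complex_vector.subspace_span)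

text \<open>A maximal independent subset of \<open>W\<close> is finite, since an independent set
  inside the span of \<open>F\<close> cannot exceed \<open>F\<close> in size.\<close>

lemma subspace_of_span_finite:
  fixes F :: "'a::complex_vector set"
  assumes "finite F" "complex_vector.subspace W" "W \<subseteq> complex_vector.span F"
  obtains B where "finite B" "W = complex_vector.span B"
proof -
  obtain B where B: "B \<subseteq> W" "complex_vector.independent B" "W \<subseteq> complex_vector.span B"
    by (rule complex_vector.maximal_independent_subset)
  then have "finite B"
    using complex_vector.independent_span_bound[OF assms(1), of B] assms(3) by auto
  moreover have "W = complex_vector.span B"
    using complex_vector.span_subspace[OF B(1,3) assms(2)] by simp
  ultimately show ?thesis by (rule that)
qed

text \<open>\<open>G\<close> is built by running through \<open>F\<close> and adding
  \<open>f\<close> only when it is not congruent modulo \<open>V\<close> to a vector already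
  spanned; this keeps the intersection with \<open>V\<close> trivial.\<close>

lemma finite_algebraic_complement:
  fixes F :: "'a::complex_vector set"
  assumes V: "complex_vector.subspace V" and "finite F"
  shows "\<exists>G. finite G \<and> complex_vector.span G \<inter> V = {0} \<and>
    (\<forall>f\<in>complex_vector.span F. \<exists>g\<in>complex_vector.span G. f - g \<in> V)"
  using assms(2)
proof induction
  case empty
  show ?case
    using complex_vector.subspace_0[OF V] by (intro exI[of _ "{}"]) auto
next
  case (insert f F)
  then obtain G where G: "finite G" "complex_vector.span G \<inter> V = {0}"
    "\<And>x. x \<in> complex_vector.span F \<Longrightarrow> \<exists>g\<in>complex_vector.span G. x - g \<in> V"
    by blast
  show ?case
  proof (cases "\<exists>g\<in>complex_vector.span G. f - g \<in> V")
    case True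
    then obtain g where g: "g \<in> complex_vector.span G" "f - g \<in> V" by auto
    have "\<exists>g\<in>complex_vector.span G. x - g \<in> V" if "x \<in> complex_vector.span (insert f F)" for x
    proof -
      from that obtain k where "x - k *\<^sub>C f \<in> complex_vector.span F"
        by (auto simp: complex_vector.span_insert)
      then obtain h where h: "h \<in> complex_vector.span G" "x - k *\<^sub>C f - h \<in> V"
        using G(3) by blast
      have "x - (h + k *\<^sub>C g) = (x - k *\<^sub>C f - h) + k *\<^sub>C (f - g)"
        by (simp add: complex_vector.scale_right_diff_distrib)
      also have "\<dots> \<in> V"
        by (intro complex_vector.subspace_add[OF V] complex_vector.subspace_scale[OF V] h g)
      finally show ?thesis
        using h g by (blast intro: complex_vector.span_add complex_vector.span_scale)
    qed
    with G show ?thesis by blast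
  next
    case False
    \<comment> \<open>A nonzero coefficient \<open>k\<close> could be divided out, making
      \<open>f\<close> congruent modulo \<open>V\<close> to a vector in the span of
      \<open>G\<close>, against the case assumption.\<close>
    have "v = 0" if v: "v \<in> V" "v - k *\<^sub>C f \<in> complex_vector.span G" for v k
    proof (cases "k = 0")
      case True
      with v G(2) show ?thesis by auto
    next
      case k: False
      have "inverse k *\<^sub>C v \<in> V"
        by (rule complex_vector.subspace_scale[OF V v(1)])
      moreover have "f - (- inverse k) *\<^sub>C (v - k *\<^sub>C f) = inverse k *\<^sub>C v"
        using k by (simp add: complex_vector.scale_right_diff_distrib scaleC_scaleC scaleC_one)
      moreover have "(- inverse k) *\<^sub>C (v - k *\<^sub>C f) \<in> complex_vector.span G"
        by (rule complex_vector.span_scale[OF v(2)])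
      ultimately show ?thesis
        using False by metis
    qed
    then have "complex_vector.span (insert f G) \<inter> V = {0}"
      using complex_vector.subspace_0[OF V] complex_vector.span_zero[of "insert f G"]
      by (auto simp: complex_vector.span_insert)
    moreover have "\<exists>g\<in>complex_vector.span (insert f G). x - g \<in> V"
      if "x \<in> complex_vector.span (insert f F)" for x
    proof -
      from that obtain k where "x - k *\<^sub>C f \<in> complex_vector.span F"
        by (auto simp: complex_vector.span_insert)
      then obtain h where h: "h \<in> complex_vector.span G" "x - k *\<^sub>C f - h \<in> V"
        using G(3) by blast
      then show ?thesis
        by (intro bexI[of _ "h + k *\<^sub>C f"])
          (auto simp: complex_vector.span_insert algebra_simps intro: exI[of _ k])
    qed
    ultimately show ?thesis
      using G(1) by (intro exI[of _ "insert f G"]) auto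
  qed
qed

text \<open>A finite-dimensional algebraic complement is automatically closed, so it is a
  topological one.\<close>

lemma exists_direct_sum:
  fixes V :: "'a::complex_normed_vector set"
  assumes V: "complex_vector.subspace V" "closed V" and "finite_dim_quotient V"
  shows "\<exists>W. direct_sum V W"
proof -
  obtain F where F: "finite F" "\<And>x. \<exists>y\<in>complex_vector.span F. x - y \<in> V"
    using assms(3) by (auto simp: finite_dim_quotient_def)
  obtain G where G: "finite G" "complex_vector.span G \<inter> V = {0}"
    "\<And>f. f \<in> complex_vector.span F \<Longrightarrow> \<exists>g\<in>complex_vector.span G. f - g \<in> V"
    using finite_algebraic_complement[OF V(1) F(1)] by blast
  have "\<exists>v w. x = v + w \<and> v \<in> V \<and> w \<in> complex_vector.span G" for x
  proof -
    obtain y g where y: "x - y \<in> V" "g \<in> complex_vector.span G" "y - g \<in> V"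
      using F(2) G(3) by metis
    have "x = ((x - y) + (y - g)) + g" by simp
    then show ?thesis
      using y complex_vector.subspace_add[OF V(1) y(1,3)] by blast
  qed
  then show ?thesis
    using V G closed_span_finite[OF G(1)] unfolding direct_sum_def
    by (intro exI[of _ "complex_vector.span G"]) (auto simp: complex_vector.subspace_span)
qed

section \<open>Bounded complex-linear operators as a closed subspace\<close>

lemma cblinear_module_hom:
  "T \<in> cblinear \<Longrightarrow> module_hom (*\<^sub>C) (*\<^sub>C) (blinfun_apply T)"
  by unfold_locales (simp_all add: cblinear_def blinfun.add_right)

lemma subspace_cblinear: "complex_vector.subspace (cblinear :: ('a::complex_normed_vector \<Rightarrow>\<^sub>L 'a) set)"
  by (rule complex_vector.subspaceI)
    (auto simp: cblinear_def blinfun.add_left scaleC_blinfun.rep_eq scaleC_add_right scaleC_scaleC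
      mult.commute)

text \<open>Evaluation at a vector is continuous in the operator norm, so complex linearity survives
  limits. This is how the series coefficients inherit it from the operators \<open>A z\<close> and
  their inverses.\<close>

lemma closed_cblinear: "closed (cblinear :: ('a::complex_normed_vector \<Rightarrow>\<^sub>L 'a) set)"
  unfolding closed_sequential_limits
proof (intro allI impI, elim conjE)
  fix s and T :: "'a \<Rightarrow>\<^sub>L 'a"
  assume s: "\<forall>n. s n \<in> cblinear" and lim: "s \<longlonglongrightarrow> T"
  have "T (c *\<^sub>C x) = c *\<^sub>C T x" for c x
  proof (rule LIMSEQ_unique)
    show "(\<lambda>n. s n (c *\<^sub>C x)) \<longlonglongrightarrow> T (c *\<^sub>C x)"
      by (intro tendsto_intros lim)
    have "(\<lambda>n. c *\<^sub>C s n x) \<longlonglongrightarrow> c *\<^sub>C T x"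
      by (intro tendsto_intros lim)
    then show "(\<lambda>n. s n (c *\<^sub>C x)) \<longlonglongrightarrow> c *\<^sub>C T x"
      using s by (simp add: cblinear_def)
  qed
  then show "T \<in> cblinear" by (simp add: cblinear_def)
qed


section \<open>Asymptotic expansions\<close>

text \<open>An asymptotic expansion in a punctured neighbourhood: each coefficient is the limit of a
  remainder quotient. This form keeps uniqueness and products elementary, with no rearrangement of
  convergent series.\<close>

definition has_expansion ::
    "(complex \<Rightarrow> 'b::complex_normed_vector) \<Rightarrow> (nat \<Rightarrow> 'b) \<Rightarrow> complex \<Rightarrow> bool" where
  "has_expansion f c z0 \<longleftrightarrow>
     (\<forall>n. ((\<lambda>z. inverse ((z - z0) ^ n) *\<^sub>C (f z - (\<Sum>j<n. (z - z0) ^ j *\<^sub>C c j)))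
        \<longlongrightarrow> c n) (at z0))"

lemma has_expansionD:
  "has_expansion f c z0 \<Longrightarrow>
     ((\<lambda>z. inverse ((z - z0) ^ n) *\<^sub>C (f z - (\<Sum>j<n. (z - z0) ^ j *\<^sub>C c j))) \<longlongrightarrow> c n) (at z0)"
  by (simp add: has_expansion_def)

lemma eventually_at_neq: "\<forall>\<^sub>F z in at (z0::complex). z \<noteq> z0"
  by (simp add: eventually_at_filter)

lemma inverse_power_Suc_scaleC:
  assumes "w \<noteq> 0"
  shows "inverse (w ^ n) *\<^sub>C (inverse w *\<^sub>C x - (\<Sum>j<n. w ^ j *\<^sub>C y j)) =
    inverse (w ^ Suc n) *\<^sub>C (x - (\<Sum>j<n. w ^ Suc j *\<^sub>C y j))"
proof -
  have "x - (\<Sum>j<n. w ^ Suc j *\<^sub>C y j) = w *\<^sub>C (inverse w *\<^sub>C x - (\<Sum>j<n. w ^ j *\<^sub>C y j))"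
    using assms by (simp add: complex_vector.scale_right_diff_distrib complex_vector.scale_sum_right
        scaleC_scaleC scaleC_one)
  then show ?thesis
    using assms by (simp add: scaleC_scaleC)
qed

text \<open>The remainder of order \<open>Suc n\<close> becomes one of order \<open>n\<close> after
  division by \<open>z - z0\<close>; this drives the induction for products.\<close>

lemma has_expansion_shift:
  assumes "has_expansion f c z0"
  shows "has_expansion (\<lambda>z. inverse (z - z0) *\<^sub>C (f z - c 0)) (\<lambda>j. c (Suc j)) z0"
  unfolding has_expansion_def
proof
  fix n
  have "inverse ((z - z0) ^ Suc n) *\<^sub>C (f z - (\<Sum>j<Suc n. (z - z0) ^ j *\<^sub>C c j)) =
      inverse ((z - z0) ^ n) *\<^sub>C
        (inverse (z - z0) *\<^sub>C (f z - c 0) - (\<Sum>j<n. (z - z0) ^ j *\<^sub>C c (Suc j)))"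
    if "z \<noteq> z0" for z
    using that unfolding sum.lessThan_Suc_shift
    by (simp add: inverse_power_Suc_scaleC scaleC_one diff_diff_eq)
  then show "((\<lambda>z. inverse ((z - z0) ^ n) *\<^sub>C
        (inverse (z - z0) *\<^sub>C (f z - c 0) - (\<Sum>j<n. (z - z0) ^ j *\<^sub>C c (Suc j)))) \<longlongrightarrow> c (Suc n)) (at z0)"
    using has_expansionD[OF assms, of "Suc n"]
    by (elim Lim_transform_eventually) (auto intro: eventually_mono[OF eventually_at_neq])
qed

text \<open>By strong induction every remainder quotient lies in \<open>V\<close> near
  \<open>z0\<close>, hence so does its limit.\<close>

lemma has_expansion_in_closed_subspace:
  fixes f :: "complex \<Rightarrow> 'b::complex_normed_vector"
  assumes f: "has_expansion f c z0"
    and V: "complex_vector.subspace V" "closed V" and ev: "\<forall>\<^sub>F z in at z0. f z \<in> V"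
  shows "c n \<in> V"
proof (induction n rule: less_induct)
  case (less n)
  have "\<forall>\<^sub>F z in at z0. inverse ((z - z0) ^ n) *\<^sub>C (f z - (\<Sum>j<n. (z - z0) ^ j *\<^sub>C c j)) \<in> V"
    using ev
    by (rule eventually_mono)
      (intro complex_vector.subspace_scale[OF V(1)] complex_vector.subspace_diff[OF V(1)]
        complex_vector.subspace_sum[OF V(1)] less, auto)
  then show ?case
    using V(2) has_expansionD[OF f] by (intro Lim_in_closed_set) auto
qed

text \<open>Once the coefficients below \<open>n\<close> agree, the remainder quotients of order
  \<open>n\<close> agree near \<open>z0\<close>, and limits are unique.\<close>

lemma has_expansion_unique:
  assumes f: "has_expansion f c z0" and g: "has_expansion g d z0"
    and ev: "\<forall>\<^sub>F z in at z0. f z = g z"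
  shows "c n = d n"
proof (induction n rule: less_induct)
  case (less n)
  have "((\<lambda>z. inverse ((z - z0) ^ n) *\<^sub>C (f z - (\<Sum>j<n. (z - z0) ^ j *\<^sub>C c j))) \<longlongrightarrow> d n) (at z0)"
    using has_expansionD[OF g, of n]
    by (rule Lim_transform_eventually) (use ev in eventually_elim, simp add: less)
  then show ?case
    using has_expansionD[OF f] by (intro tendsto_unique[of "at z0"]) auto
qed

text \<open>Induction on the order through \<open>f z = c 0 + (z - z0) *\<^sub>C f1 z\<close>: the
  part with \<open>c 0\<close> follows the expansion of \<open>g\<close>, and the rest is the
  induction hypothesis for the shifted \<open>f1\<close>, which is why \<open>f\<close> and
  \<open>c\<close> are generalized. Complex linearity of \<open>c 0\<close> lets scalars pass to the
  outside.\<close>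

lemma has_expansion_compose:
  fixes f g :: "complex \<Rightarrow> 'a::complex_normed_vector \<Rightarrow>\<^sub>L 'a"
  assumes f: "has_expansion f c z0" and c: "\<And>j. c j \<in> cblinear" and g: "has_expansion g d z0"
  shows "has_expansion (\<lambda>z. f z o\<^sub>L g z) (\<lambda>n. \<Sum>i\<le>n. c i o\<^sub>L d (n - i)) z0"
  unfolding has_expansion_def
proof
  fix n
  show "((\<lambda>z. inverse ((z - z0) ^ n) *\<^sub>C ((f z o\<^sub>L g z) - (\<Sum>k<n. (z - z0) ^ k *\<^sub>C (\<Sum>i\<le>k. c i o\<^sub>L d (k - i)))))
      \<longlongrightarrow> (\<Sum>i\<le>n. c i o\<^sub>L d (n - i))) (at z0)"
    using f c
  proof (induction n arbitrary: f c)
    case 0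
    show ?case
      using bounded_bilinear.tendsto[OF bounded_bilinear_blinfun_compose
          has_expansionD[OF 0(1), of 0] has_expansionD[OF g, of 0]]
      by (simp add: scaleC_one)
  next
    case (Suc n)
    let ?f1 = "\<lambda>z. inverse (z - z0) *\<^sub>C (f z - c 0)"
    let ?E = "\<lambda>k. \<Sum>i\<le>k. c (Suc i) o\<^sub>L d (k - i)"
    let ?w = "\<lambda>z. z - z0"
    note bil = bounded_bilinear_blinfun_compose
    \<comment> \<open>Splits off the term \<open>i = 0\<close>; what remains is the convolution for
      the shifted coefficients.\<close>
    have E: "(\<Sum>i\<le>Suc k. c i o\<^sub>L d (Suc k - i)) = (c 0 o\<^sub>L d (Suc k)) + ?E k" for k
      by (simp add: sum.atMost_Suc_shift del: sum.atMost_Suc)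
    have "((\<lambda>z. (c 0 o\<^sub>L (inverse (?w z ^ Suc n) *\<^sub>C (g z - (\<Sum>k<Suc n. ?w z ^ k *\<^sub>C d k)))) +
        inverse (?w z ^ n) *\<^sub>C ((?f1 z o\<^sub>L g z) - (\<Sum>k<n. ?w z ^ k *\<^sub>C ?E k)))
        \<longlongrightarrow> (c 0 o\<^sub>L d (Suc n)) + ?E n) (at z0)"
      by (intro tendsto_add bounded_bilinear.tendsto[OF bil tendsto_const has_expansionD[OF g]]
          Suc.IH[OF has_expansion_shift[OF Suc.prems(1)]] Suc.prems(2))
    then show ?case
      unfolding E
    proof (rule Lim_transform_eventually, intro eventually_mono[OF eventually_at_neq])
      fix z assume z: "z \<noteq> z0"
      have sc: "c 0 o\<^sub>L (k *\<^sub>C X) = k *\<^sub>C (c 0 o\<^sub>L X)" for k and X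
        using Suc.prems(2)[of 0] by (intro blinfun_eqI) (simp add: scaleC_blinfun.rep_eq cblinear_def)
      have sl: "(k *\<^sub>C Y) o\<^sub>L X = k *\<^sub>C (Y o\<^sub>L X)" for k and X Y :: "'a \<Rightarrow>\<^sub>L 'a"
        by (intro blinfun_eqI) (simp add: scaleC_blinfun.rep_eq)
      have 1: "inverse (?w z ^ n) *\<^sub>C ((?f1 z o\<^sub>L g z) - (\<Sum>k<n. ?w z ^ k *\<^sub>C ?E k)) =
          inverse (?w z ^ Suc n) *\<^sub>C (((f z - c 0) o\<^sub>L g z) - (\<Sum>k<n. ?w z ^ Suc k *\<^sub>C ?E k))"
        using z by (simp only: sl inverse_power_Suc_scaleC right_minus_eq not_False_eq_True)
      have 2: "(c 0 o\<^sub>L (g z - (\<Sum>k<Suc n. ?w z ^ k *\<^sub>C d k))) =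
          (c 0 o\<^sub>L g z) - (\<Sum>k<Suc n. ?w z ^ k *\<^sub>C (c 0 o\<^sub>L d k))"
        by (simp only: bounded_bilinear.diff_right[OF bil] bounded_bilinear.sum_right[OF bil] sc)
      have 3: "(\<Sum>k<Suc n. ?w z ^ k *\<^sub>C (\<Sum>i\<le>k. c i o\<^sub>L d (k - i))) =
          (\<Sum>k<Suc n. ?w z ^ k *\<^sub>C (c 0 o\<^sub>L d k)) + (\<Sum>k<n. ?w z ^ Suc k *\<^sub>C ?E k)"
        unfolding sum.lessThan_Suc_shift E
        by (simp add: scaleC_add_right sum.distrib)
      show "(c 0 o\<^sub>L (inverse (?w z ^ Suc n) *\<^sub>C (g z - (\<Sum>k<Suc n. ?w z ^ k *\<^sub>C d k)))) +
          inverse (?w z ^ n) *\<^sub>C ((?f1 z o\<^sub>L g z) - (\<Sum>k<n. ?w z ^ k *\<^sub>C ?E k)) =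
        inverse (?w z ^ Suc n) *\<^sub>C
          ((f z o\<^sub>L g z) - (\<Sum>k<Suc n. ?w z ^ k *\<^sub>C (\<Sum>i\<le>k. c i o\<^sub>L d (k - i))))"
        unfolding 1 sc 2 3 scaleC_add_right[symmetric]
        by (simp add: bounded_bilinear.diff_left[OF bil] algebra_simps)
    qed
  qed
qed

text \<open>Convergence at radius \<open>r\<close> bounds the coefficients by
  \<open>M / r ^ j\<close>. For \<open>cmod (z - z0) < r / 2\<close> the remainder quotient then
  differs from \<open>c n\<close> by at most \<open>cmod (z - z0) * C\<close>, by comparison with a
  geometric series.\<close>

lemma sums_imp_has_expansion:
  fixes f :: "complex \<Rightarrow> 'b::complex_banach"
  assumes ev: "\<forall>\<^sub>F z in at z0. (\<lambda>j. (z - z0) ^ j *\<^sub>C c j) sums f z"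
  shows "has_expansion f c z0"
  unfolding has_expansion_def
proof
  fix n
  obtain e where e: "e > 0"
    and sums: "\<And>z. z \<noteq> z0 \<Longrightarrow> dist z z0 < e \<Longrightarrow> (\<lambda>j. (z - z0) ^ j *\<^sub>C c j) sums f z"
    using ev by (auto simp: eventually_at)
  define r where "r = e / 2"
  have r: "r > 0" "r < e" using e by (auto simp: r_def)
  have "(\<lambda>j. complex_of_real r ^ j *\<^sub>C c j) sums f (z0 + of_real r)"
    using sums[of "z0 + of_real r"] r by (simp add: dist_norm)
  then have "(\<lambda>j. complex_of_real r ^ j *\<^sub>C c j) \<longlonglongrightarrow> 0"
    by (simp add: sums_iff summable_LIMSEQ_zero)
  then have "Bseq (\<lambda>j. complex_of_real r ^ j *\<^sub>C c j)"
    by (intro convergent_imp_Bseq) (auto simp: convergent_def)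
  then obtain M where M: "\<And>j. norm (complex_of_real r ^ j *\<^sub>C c j) \<le> M"
    by (auto simp: Bseq_def)
  have bound: "norm (c j) * r ^ j \<le> M" for j
    using M[of j] r by (simp add: norm_scaleC norm_power mult.commute)
  define q where "q = (\<lambda>z. inverse ((z - z0) ^ n) *\<^sub>C (f z - (\<Sum>j<n. (z - z0) ^ j *\<^sub>C c j)))"
  \<comment> \<open>The factor 2 is the sum of the geometric series of ratio \<open>1 / 2\<close>;
    the power \<open>Suc n\<close> comes from the first coefficient after
    \<open>c n\<close>.\<close>
  define C where "C = 2 * (M / r ^ Suc n)"
  have le: "norm (q z - c n) \<le> cmod (z - z0) * C" if z: "z \<noteq> z0" "dist z z0 < r / 2" for z
  proof -
    let ?w = "z - z0"
    have inv: "inverse (?w ^ n) * ?w ^ n = 1"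
      using z(1) by simp
    have "(\<lambda>j. ?w ^ (j + Suc n) *\<^sub>C c (j + Suc n)) sums (f z - (\<Sum>j<Suc n. ?w ^ j *\<^sub>C c j))"
      using sums[of z] z r by (intro sums_split_initial_segment) auto
    then have "(\<lambda>j. inverse (?w ^ n) *\<^sub>C (?w ^ (j + Suc n) *\<^sub>C c (j + Suc n))) sums
        (inverse (?w ^ n) *\<^sub>C (f z - (\<Sum>j<Suc n. ?w ^ j *\<^sub>C c j)))"
      by (rule bounded_linear.sums[OF bounded_linear_scaleC])
    also have "f z - (\<Sum>j<Suc n. ?w ^ j *\<^sub>C c j) = (f z - (\<Sum>j<n. ?w ^ j *\<^sub>C c j)) - ?w ^ n *\<^sub>C c n"
      by (simp add: diff_diff_eq)
    also have "inverse (?w ^ n) *\<^sub>C \<dots> = q z - c n"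
      unfolding q_def complex_vector.scale_right_diff_distrib[of _ _ "?w ^ n *\<^sub>C c n"] scaleC_scaleC inv
        scaleC_one ..
    also have "(\<lambda>j. inverse (?w ^ n) *\<^sub>C (?w ^ (j + Suc n) *\<^sub>C c (j + Suc n))) =
        (\<lambda>j. ?w ^ Suc j *\<^sub>C c (j + Suc n))"
    proof
      fix j
      have "inverse (?w ^ n) * ?w ^ (j + Suc n) = (inverse (?w ^ n) * ?w ^ n) * ?w ^ Suc j"
        by (simp add: power_add)
      then show "inverse (?w ^ n) *\<^sub>C (?w ^ (j + Suc n) *\<^sub>C c (j + Suc n)) = ?w ^ Suc j *\<^sub>C c (j + Suc n)"
        by (simp only: inv scaleC_scaleC mult_1_left)
    qed
    finally have s: "(\<lambda>j. ?w ^ Suc j *\<^sub>C c (j + Suc n)) sums (q z - c n)" .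
    have term_le: "norm (?w ^ Suc j *\<^sub>C c (j + Suc n)) \<le> cmod ?w * (M / r ^ Suc n) * (1 / 2) ^ j" for j
    proof -
      have "norm (?w ^ Suc j *\<^sub>C c (j + Suc n)) = cmod ?w * (cmod ?w ^ j * norm (c (j + Suc n)))"
        by (simp add: norm_scaleC norm_mult norm_power)
      also have "\<dots> \<le> cmod ?w * ((r / 2) ^ j * (M / r ^ (j + Suc n)))"
      proof (intro mult_left_mono mult_mono power_mono)
        show "norm (c (j + Suc n)) \<le> M / r ^ (j + Suc n)"
          using bound[of "j + Suc n"] r by (simp add: pos_le_divide_eq)
      qed (use z r in \<open>auto simp: dist_norm\<close>)
      also have "\<dots> = cmod ?w * (M / r ^ Suc n) * (1 / 2) ^ j"
        using r by (simp add: power_add power_divide)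
      finally show ?thesis .
    qed
    have geo: "(\<lambda>j. cmod ?w * (M / r ^ Suc n) * (1 / 2) ^ j) sums (cmod ?w * (M / r ^ Suc n) * 2)"
      using geometric_sums[of "1 / 2 :: real"] by (intro sums_mult) simp
    have "norm (q z - c n) \<le> cmod ?w * (M / r ^ Suc n) * 2"
      using norm_sums_le[OF s geo term_le] .
    then show ?thesis by (simp add: C_def mult_ac)
  qed
  have ev_le: "\<forall>\<^sub>F z in at z0. norm (q z - c n) \<le> cmod (z - z0) * C"
    unfolding eventually_at using r(1) le by (intro exI[of _ "r / 2"] conjI ballI impI) simp_all
  have "((\<lambda>z. cmod (z - z0) * C) \<longlongrightarrow> cmod (z0 - z0) * C) (at z0)"
    by (intro tendsto_intros)
  then have "((\<lambda>z. cmod (z - z0) * C) \<longlongrightarrow> 0) (at z0)"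
    by simp
  with ev_le have "((\<lambda>z. q z - c n) \<longlongrightarrow> 0) (at z0)"
    by (rule Lim_null_comparison)
  then show "((\<lambda>z. inverse ((z - z0) ^ n) *\<^sub>C (f z - (\<Sum>j<n. (z - z0) ^ j *\<^sub>C c j))) \<longlongrightarrow> c n) (at z0)"
    unfolding q_def by (rule LIM_zero_cancel)
qed


section \<open>Complementary subspaces\<close>

lemma proj_onto_eqI:
  assumes VW: "direct_sum V W" and w: "w \<in> W" "x - w \<in> V"
  shows "proj_onto W V x = w"
  unfolding proj_onto_def
proof (rule the_equality)
  fix w' assume w': "w' \<in> W \<and> x - w' \<in> V"
  have sub: "complex_vector.subspace V" "complex_vector.subspace W"
    using VW by (auto simp: direct_sum_def)
  have "w' - w \<in> W"
    using sub w w' by (auto intro: complex_vector.subspace_diff)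
  moreover have "w' - w \<in> V"
    using complex_vector.subspace_diff[OF sub(1) w(2), of "x - w'"] w' by simp
  moreover have "V \<inter> W = {0}"
    using VW by (simp add: direct_sum_def)
  ultimately have "w' - w \<in> {0}" by blast
  then show "w' = w" by simp
qed (use w in auto)

lemma direct_sumE:
  assumes "direct_sum V W"
  obtains v w where "v \<in> V" "w \<in> W" "x = v + w"
proof -
  have "x \<in> {v + w | v w. v \<in> V \<and> w \<in> W}"
    using assms by (simp add: direct_sum_def)
  then show ?thesis using that by blast
qed

lemma proj_onto:
  assumes VW: "direct_sum V W"
  shows proj_onto_in: "proj_onto W V x \<in> W" and diff_proj_onto_in: "x - proj_onto W V x \<in> V"
proof -
  obtain v w where vw: "v \<in> V" "w \<in> W" "x = v + w"
    using VW by (rule direct_sumE)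
  then have "proj_onto W V x = w"
    by (intro proj_onto_eqI[OF VW]) auto
  with vw show "proj_onto W V x \<in> W" "x - proj_onto W V x \<in> V" by auto
qed

lemma subspace_op_ran: "T \<in> cblinear \<Longrightarrow> complex_vector.subspace (op_ran T)"
  unfolding op_ran_def
  by (rule module_hom.subspace_image[OF cblinear_module_hom complex_vector.subspace_UNIV])

lemma subspace_op_ker: "T \<in> cblinear \<Longrightarrow> complex_vector.subspace (op_ker T)"
  unfolding op_ker_def by (rule module_hom.subspace_kernel[OF cblinear_module_hom])

text \<open>On the range the projection term vanishes, and \<open>T\<close> maps \<open>Kc\<close>
  bijectively onto its range: injectively because \<open>Kc\<close> meets the kernel only in
  \<open>0\<close>, surjectively because kernel components are killed.\<close>

lemma gen_inverse_right_inverse: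
  assumes R: "direct_sum (op_ran T) Rc" and K: "direct_sum (op_ker T) Kc" and y: "y \<in> op_ran T"
  shows "T (gen_inverse T Rc Kc y) = y"
proof -
  have "proj_onto Rc (op_ran T) y = 0"
    using R y by (intro proj_onto_eqI) (auto simp: direct_sum_def complex_vector.subspace_0)
  then have eq: "gen_inverse T Rc Kc y = the_inv_into Kc (blinfun_apply T) y"
    by (simp add: gen_inverse_def)
  have "inj_on (blinfun_apply T) Kc"
  proof (rule inj_onI)
    fix u v assume uv: "u \<in> Kc" "v \<in> Kc" "T u = T v"
    have "complex_vector.subspace Kc"
      using K by (simp add: direct_sum_def)
    then have "u - v \<in> Kc"
      using uv by (intro complex_vector.subspace_diff)
    moreover have "u - v \<in> op_ker T"
      using uv by (simp add: op_ker_def blinfun.diff_right)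
    moreover have "op_ker T \<inter> Kc = {0}"
      using K by (simp add: direct_sum_def)
    ultimately have "u - v \<in> {0}" by blast
    then show "u = v" by simp
  qed
  moreover have "y \<in> blinfun_apply T ` Kc"
  proof -
    obtain x where x: "y = T x" using y by (auto simp: op_ran_def)
    obtain k u where "k \<in> op_ker T" "u \<in> Kc" "x = k + u"
      using K by (rule direct_sumE)
    with x show ?thesis by (auto simp: op_ker_def blinfun.add_right)
  qed
  ultimately show ?thesis
    unfolding eq by (rule f_the_inv_into_f)
qed


section \<open>Coefficients of the inverse\<close>

text \<open>
  \<open>b i\<close> stands for \<open>N\<^bsub>i - m\<^esub>\<close>, the coefficients of \<open>(z - z0)\<^sup>m A(z)\<^sup>-\<^sup>1\<close>.
\<close>

locale inverse_expansion =
  fixes a b :: "nat \<Rightarrow> 'a::complex_normed_vector \<Rightarrow>\<^sub>L 'a" and m :: nat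
  assumes cblinear_a: "a j \<in> cblinear" and cblinear_b: "b j \<in> cblinear"
    and left: "(\<Sum>i\<le>n. b i o\<^sub>L a (n - i)) = (if n = m then id_blinfun else 0)"
    and right: "(\<Sum>i\<le>n. a i o\<^sub>L b (n - i)) = (if n = m then id_blinfun else 0)"
begin

lemma left_apply: "(\<Sum>i\<le>n. b i (a (n - i) x)) = (if n = m then x else 0)"
  using arg_cong[OF left[of n], of "\<lambda>T. blinfun_apply T x"] by (simp add: blinfun.sum_left)

lemma right_apply: "(\<Sum>i\<le>n. a i (b (n - i) x)) = (if n = m then x else 0)"
  using arg_cong[OF right[of n], of "\<lambda>T. blinfun_apply T x"] by (simp add: blinfun.sum_left)

text \<open>
  \<open>b k\<close> maps the range of \<open>a 0\<close>, which has finite codimension, into the sum of the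
  ranges of the \<open>b i\<close> with \<open>i < k\<close>.
\<close>

lemma finite_rank:
  assumes "finite_dim_quotient (op_ran (a 0))" and "k < m"
  shows "\<exists>F. finite F \<and> range (b k) \<subseteq> complex_vector.span F"
  using assms(2)
proof (induction k rule: less_induct)
  case (less k)
  have "\<forall>i\<in>{..<k}. \<exists>F. finite F \<and> range (b i) \<subseteq> complex_vector.span F"
    using less by auto
  then obtain F where F: "\<And>i. i < k \<Longrightarrow> finite (F i) \<and> range (b i) \<subseteq> complex_vector.span (F i)"
    by (auto dest!: bchoice)
  obtain Q where Q: "finite Q" "\<And>x. \<exists>y\<in>complex_vector.span Q. x - y \<in> op_ran (a 0)"
    using assms(1) by (auto simp: finite_dim_quotient_def)
  \<comment> \<open>Generators of the earlier ranges, together with the images of representatives of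
    the quotient by the range of \<open>a 0\<close>.\<close>
  let ?F = "b k ` Q \<union> (\<Union>i<k. F i)"
  have "b k x \<in> complex_vector.span ?F" for x
  proof -
    obtain y u where y: "y \<in> complex_vector.span Q" and u: "x - y = a 0 u"
      using Q(2)[of x] unfolding op_ran_def by blast
    have "b k y \<in> complex_vector.span (b k ` Q)"
      using y by (simp add: module_hom.span_image[OF cblinear_module_hom[OF cblinear_b]])
    then have 1: "b k y \<in> complex_vector.span ?F"
      using complex_vector.span_mono[of "b k ` Q" ?F] by auto
    have "b i (a (k - i) u) \<in> complex_vector.span ?F" if "i < k" for i
    proof -
      have "b i (a (k - i) u) \<in> complex_vector.span (F i)"
        using F[OF that] by auto
      moreover have "complex_vector.span (F i) \<subseteq> complex_vector.span ?F"
        using that by (intro complex_vector.span_mono) auto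
      ultimately show ?thesis by blast
    qed
    then have 2: "(\<Sum>i<k. b i (a (k - i) u)) \<in> complex_vector.span ?F"
      by (intro complex_vector.span_sum) auto
    \<comment> \<open>The left identity of order \<open>k\<close> has right-hand side zero because
      \<open>k < m\<close>.\<close>
    have "b k (a 0 u) + (\<Sum>i<k. b i (a (k - i) u)) = 0"
      using left_apply[where n = k and x = u] less.prems
      by (simp add: lessThan_Suc_atMost[symmetric] add.commute)
    moreover have "b k x = b k y + b k (a 0 u)"
      unfolding u[symmetric] blinfun.diff_right by simp
    ultimately have "b k x = b k y - (\<Sum>i<k. b i (a (k - i) u))"
      by (simp add: eq_neg_iff_add_eq_0[symmetric])
    with 1 2 show ?thesis
      by (simp add: complex_vector.span_diff)
  qed
  moreover have "finite ?F"
    using F Q(1) by auto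
  ultimately show ?case by blast
qed

text \<open>
  By the identity of order \<open>m\<close>, \<open>a 0 o\<^sub>L b m\<close> differs from the identity by a finite rank operator
  \<open>E\<close>. Hence \<open>x\<close> is in the range of \<open>a 0\<close> iff \<open>E x\<close> is, which is a condition on a vector of a
  finite-dimensional space.
\<close>

lemma closed_op_ran:
  assumes "finite_dim_quotient (op_ran (a 0))"
  shows "closed (op_ran (a 0))"
proof -
  \<comment> \<open>All terms of the right identity of order \<open>m\<close> except
    \<open>a 0 o\<^sub>L b m\<close>; each contains some \<open>b i\<close> with
    \<open>i < m\<close>, hence has finite rank.\<close>
  define E where "E = (\<Sum>i<m. a (Suc i) o\<^sub>L b (m - Suc i))"
  have "\<forall>i\<in>{..<m}. \<exists>F. finite F \<and> range (b i) \<subseteq> complex_vector.span F"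
    using finite_rank[OF assms] by auto
  then obtain F where F: "\<And>i. i < m \<Longrightarrow> finite (F i) \<and> range (b i) \<subseteq> complex_vector.span (F i)"
    by (auto dest!: bchoice)
  define G where "G = (\<Union>i<m. a (Suc i) ` F (m - Suc i))"
  have G: "finite G" using F by (auto simp: G_def)
  have "a (Suc i) (b (m - Suc i) x) \<in> complex_vector.span G" if "i < m" for i x
  proof -
    have "b (m - Suc i) x \<in> complex_vector.span (F (m - Suc i))"
      using F[of "m - Suc i"] that by auto
    then have "a (Suc i) (b (m - Suc i) x) \<in> complex_vector.span (a (Suc i) ` F (m - Suc i))"
      by (simp add: module_hom.span_image[OF cblinear_module_hom[OF cblinear_a]])
    moreover have "a (Suc i) ` F (m - Suc i) \<subseteq> G"
      using that by (auto simp: G_def)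
    ultimately show ?thesis
      using complex_vector.span_mono by blast
  qed
  then have E_in: "E x \<in> complex_vector.span G" for x
    by (auto simp: E_def blinfun.sum_left intro: complex_vector.span_sum)
  have decomp: "a 0 (b m x) + E x = x" for x
    using right_apply[where n = m and x = x]
    by (cases m) (simp_all add: E_def blinfun.sum_left sum.atMost_Suc_shift lessThan_Suc_atMost
        del: sum.atMost_Suc)
  have sub: "complex_vector.subspace (op_ran (a 0))"
    by (rule subspace_op_ran[OF cblinear_a])
  let ?W = "op_ran (a 0) \<inter> complex_vector.span G"
  have "blinfun_apply E -` ?W = op_ran (a 0)"
  proof (intro set_eqI iffI)
    fix x
    have ab: "a 0 (b m x) \<in> op_ran (a 0)" by (simp add: op_ran_def)
    show "x \<in> op_ran (a 0)" if "x \<in> blinfun_apply E -` ?W"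
      using complex_vector.subspace_add[OF sub ab, of "E x"] that decomp[of x] by simp
    show "x \<in> blinfun_apply E -` ?W" if "x \<in> op_ran (a 0)"
    proof -
      have "E x = x - a 0 (b m x)"
        using decomp[of x] by (metis add_diff_cancel_left')
      then show ?thesis
        using complex_vector.subspace_diff[OF sub that ab] E_in[of x] by simp
    qed
  qed
  moreover have "closed ?W"
  proof -
    have "complex_vector.subspace ?W"
      by (intro complex_vector.subspace_inter sub complex_vector.subspace_span)
    then obtain B where "finite B" "?W = complex_vector.span B"
      using subspace_of_span_finite[OF G, of ?W] by auto
    then show ?thesis by (simp add: closed_span_finite)
  qed
  then have "closed (blinfun_apply E -` ?W)"
    by (intro closed_vimage) (auto intro!: continuous_intros)
  ultimately show ?thesis by simp
qed

lemma ex_complement: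
  assumes "finite_dim_quotient (op_ran (a 0))"
  shows "\<exists>Rc. direct_sum (op_ran (a 0)) Rc"
  using subspace_op_ran[OF cblinear_a] closed_op_ran[OF assms] assms by (rule exists_direct_sum)

section \<open>Why conditions (ii) and (iv) exclude poles of order two or more\<close>

lemma b0_on_ran:
  assumes "1 \<le> m" "x \<in> op_ran (a 0)"
  shows "b 0 x = 0"
  using assms left_apply[where n = 0] by (auto simp: op_ran_def)

text \<open>For \<open>m \<ge> 2\<close> the left identity of order 1 has right-hand side zero, and
  its other term \<open>b 1 (a 0 k)\<close> vanishes.\<close>

lemma b0_on_a1_ker:
  assumes "2 \<le> m" "k \<in> op_ker (a 0)"
  shows "b 0 (a 1 k) = 0"
  using assms left_apply[where n = 1 and x = k] by (simp add: op_ker_def)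

lemma order_one_if_a1_ker_complement:
  assumes m: "1 \<le> m" "b 0 \<noteq> 0" and "direct_sum (op_ran (a 0)) (a 1 ` op_ker (a 0))"
  shows "m = 1"
proof (rule ccontr)
  assume "m \<noteq> 1"
  with m have "2 \<le> m" by simp
  have "b 0 x = 0" for x
  proof -
    obtain v w where "v \<in> op_ran (a 0)" "w \<in> a 1 ` op_ker (a 0)" "x = v + w"
      using assms(3) by (rule direct_sumE)
    with \<open>2 \<le> m\<close> show ?thesis
      by (auto simp: blinfun.add_right b0_on_ran b0_on_a1_ker simp del: One_nat_def)
  qed
  then have "b 0 = 0" by (intro blinfun_eqI) simp
  with m(2) show False by simp
qed

text \<open>Surjectivity of \<open>S_map a Rc\<close> makes every vector of \<open>Rc\<close>
  congruent modulo the range of \<open>a 0\<close> to some \<open>a 1 k\<close> with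
  \<open>k\<close> in the kernel. For \<open>m \<ge> 2\<close> the operator \<open>b 0\<close> would
  kill all of these, and hence vanish.\<close>

lemma order_one_if_S_map_invertible:
  assumes m: "1 \<le> m" "b 0 \<noteq> 0" and Rc: "direct_sum (op_ran (a 0)) Rc"
    and inv: "invertible_between (op_ker (a 0)) Rc (S_map a Rc)"
  shows "m = 1"
proof (rule ccontr)
  assume "m \<noteq> 1"
  with m have "2 \<le> m" by simp
  have "b 0 x = 0" for x
  proof -
    obtain v w where vw: "v \<in> op_ran (a 0)" "w \<in> Rc" "x = v + w"
      using Rc by (rule direct_sumE)
    then obtain k where k: "k \<in> op_ker (a 0)" "w = S_map a Rc k"
      using inv unfolding invertible_between_def by (metis image_subset_iff)
    have "b 0 (a 1 k - w) = 0"
      using m(1) diff_proj_onto_in[OF Rc, of "a 1 k"] k(2) by (simp add: S_map_def b0_on_ran)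
    with \<open>2 \<le> m\<close> vw k(1) show ?thesis
      by (simp add: blinfun.add_right blinfun.diff_right b0_on_ran b0_on_a1_ker del: One_nat_def)
  qed
  then have "b 0 = 0" by (intro blinfun_eqI) simp
  with m(2) show False by simp
qed

end

text \<open>For \<open>m = 1\<close> the offset is one: \<open>b 0\<close> stands for
  \<open>N (-1)\<close> and \<open>b (Suc j)\<close> for \<open>N (int j)\<close>.\<close>

locale simple_pole_expansion = inverse_expansion a b 1
  for a b :: "nat \<Rightarrow> 'a::complex_normed_vector \<Rightarrow>\<^sub>L 'a"
begin

lemma b0_a0: "b 0 (a 0 x) = 0"
  using left_apply[where n = 0 and x = x] by simp

lemma b0_in_ker: "b 0 x \<in> op_ker (a 0)"
  using right_apply[where n = 0 and x = x] by (simp add: op_ker_def)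

lemma left_one: "b 0 (a 1 x) + b 1 (a 0 x) = x"
  using left_apply[where n = 1 and x = x] by simp

lemma right_one: "a 0 (b 1 x) + a 1 (b 0 x) = x"
  using right_apply[where n = 1 and x = x] by simp

lemma b0_a1: "k \<in> op_ker (a 0) \<Longrightarrow> b 0 (a 1 k) = k"
  using left_one[of k] by (simp add: op_ker_def)

lemma diff_a1_b0: "x - a 1 (b 0 x) = a 0 (b 1 x)"
  by (metis add_diff_cancel_right' right_one)

text \<open>
  Both summands are closed, being the kernels of \<open>b 0\<close> and of \<open>x \<mapsto> x - a 1 (b 0 x)\<close>.
\<close>

lemma direct_sum_a1_ker: "direct_sum (op_ran (a 0)) (a 1 ` op_ker (a 0))"
proof -
  have ran: "op_ran (a 0) = {x. b 0 x = 0}"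
  proof (intro set_eqI iffI; clarsimp simp: op_ran_def b0_a0)
    fix x assume "b 0 x = 0"
    then show "x \<in> range (a 0)"
      using diff_a1_b0[of x] by auto
  qed
  have img: "a 1 ` op_ker (a 0) = {x. a 1 (b 0 x) = x}"
  proof (intro set_eqI iffI)
    fix x assume "x \<in> {x. a 1 (b 0 x) = x}"
    then show "x \<in> a 1 ` op_ker (a 0)"
      using b0_in_ker[of x] by (intro image_eqI[of _ _ "b 0 x"]) auto
  qed (auto simp: b0_a1[simplified])
  show ?thesis
    unfolding direct_sum_def
  proof (intro conjI)
    show "complex_vector.subspace (op_ran (a 0))"
      by (rule subspace_op_ran[OF cblinear_a])
    show "complex_vector.subspace (a 1 ` op_ker (a 0))"
      by (rule module_hom.subspace_image[OF cblinear_module_hom[OF cblinear_a]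
            subspace_op_ker[OF cblinear_a]])
    show "closed (op_ran (a 0))" "closed (a 1 ` op_ker (a 0))"
      unfolding ran img by (intro closed_Collect_eq continuous_intros)+
    show "op_ran (a 0) \<inter> a 1 ` op_ker (a 0) = {0}"
      unfolding ran img by (auto simp: blinfun.zero_right)
    have "x \<in> {v + w | v w. v \<in> op_ran (a 0) \<and> w \<in> a 1 ` op_ker (a 0)}" for x
      using right_one[of x] b0_in_ker[of x] unfolding op_ran_def
      by (intro CollectI exI[of _ "a 0 (b 1 x)"] exI[of _ "a 1 (b 0 x)"] conjI) auto
    then show "{v + w | v w. v \<in> op_ran (a 0) \<and> w \<in> a 1 ` op_ker (a 0)} = UNIV"
      by blast
  qed
qed

section \<open>The operator S and the recursion, for a fixed complement of the range\<close>

context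
  fixes Rc
  assumes Rc: "direct_sum (op_ran (a 0)) Rc"
begin

text \<open>\<open>b 0\<close> vanishes on the range of \<open>a 0\<close>, so it sees only the
  component in \<open>Rc\<close>.\<close>

lemma b0_proj_onto: "b 0 (proj_onto Rc (op_ran (a 0)) x) = b 0 x"
  using b0_on_ran[OF _ diff_proj_onto_in[OF Rc, of x]] by (simp add: blinfun.diff_right)

lemma b0_S_map: "k \<in> op_ker (a 0) \<Longrightarrow> b 0 (S_map a Rc k) = k"
  by (simp add: S_map_def b0_proj_onto b0_a1[simplified])

text \<open>By the right identity of order 1, \<open>a 1 (b 0 w)\<close> and \<open>w\<close> differ
  by an element of the range of \<open>a 0\<close>. Together with \<open>b0_S_map\<close> this makes
  \<open>b 0\<close> on \<open>Rc\<close> the two-sided inverse of S.\<close>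

lemma S_map_b0: "w \<in> Rc \<Longrightarrow> S_map a Rc (b 0 w) = w"
  unfolding S_map_def
proof (rule proj_onto_eqI[OF Rc])
  have "a 1 (b 0 w) - w = a 0 (- b 1 w)"
    unfolding blinfun.minus_right diff_a1_b0[symmetric] by simp
  then show "a 1 (b 0 w) - w \<in> op_ran (a 0)"
    by (simp add: op_ran_def)
qed

lemma invertible_between_S_map: "invertible_between (op_ker (a 0)) Rc (S_map a Rc)"
  unfolding invertible_between_def
\<comment> \<open>The inverse is the restriction of \<open>b 0\<close>, and its operator norm is the
  required bound.\<close>
proof (intro conjI exI[of _ "blinfun_apply (b 0)"] exI[of _ "norm (b 0)"] allI ballI)
  show "S_map a Rc ` op_ker (a 0) \<subseteq> Rc"
    by (auto simp: S_map_def proj_onto_in[OF Rc])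
  show "norm (b 0 x) \<le> norm (b 0) * norm x" for x
    by (rule norm_blinfun)
  show "b 0 (c *\<^sub>C x) = c *\<^sub>C b 0 x" for c x
    using cblinear_b[of 0] by (simp add: cblinear_def)
qed (auto simp: b0_in_ker b0_S_map S_map_b0 blinfun.add_right)

text \<open>This is the formula for \<open>N (-1)\<close>; it also lets the recursion be proved with
  \<open>b 0\<close> in place of every \<open>S_inv\<close> term.\<close>

lemma S_inv_proj_onto: "S_inv a Rc (proj_onto Rc (op_ran (a 0)) x) = b 0 x"
proof -
  let ?w = "proj_onto Rc (op_ran (a 0)) x"
  have "inj_on (S_map a Rc) (op_ker (a 0))"
    by (rule inj_on_inverseI[of _ "blinfun_apply (b 0)"]) (rule b0_S_map)
  then have "S_inv a Rc ?w = b 0 ?w"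
    unfolding S_inv_def by (rule the_inv_into_f_eq)
      (auto simp: S_map_b0 proj_onto_in[OF Rc] b0_in_ker)
  then show ?thesis by (simp add: b0_proj_onto)
qed

text \<open>
  Write \<open>x = a 0 u + a 1 k\<close> with \<open>k = b 0 x\<close> in the kernel of \<open>a 0\<close>; the identities of order
  \<open>j + 1\<close> and \<open>j + 2\<close>, applied to \<open>u\<close> and \<open>k\<close>, express \<open>b (j + 1)\<close> on the two summands.
\<close>

lemma b_Suc_recursion:
  assumes Kc: "direct_sum (op_ker (a 0)) Kc"
  shows "b (Suc j) x =
    ((if j = 0 then id_blinfun else 0) - (\<Sum>i\<le>j. b i o\<^sub>L a (Suc j - i)))
       (gen_inverse (a 0) Rc Kc (x - a 1 (b 0 x)))
    - (\<Sum>i\<le>j. b i o\<^sub>L a (Suc (Suc j) - i)) (b 0 x)"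
proof -
  define k where "k = b 0 x"
  define u where "u = gen_inverse (a 0) Rc Kc (x - a 1 k)"
  have "a 0 u = x - a 1 k"
    unfolding u_def k_def
    by (rule gen_inverse_right_inverse[OF Rc Kc]) (simp add: diff_a1_b0[simplified] op_ran_def)
  then have x: "x = a 0 u + a 1 k" by simp
  have k: "a 0 k = 0"
    using b0_in_ker[of x] by (simp add: k_def op_ker_def)
  \<comment> \<open>The summand \<open>i = Suc j\<close> is isolated. The right-hand side is nonzero
    only for \<open>Suc j = 1\<close>, which produces the extra term at
    \<open>j = 0\<close>.\<close>
  have "b (Suc j) (a 0 u) = (if j = 0 then u else 0) - (\<Sum>i\<le>j. b i (a (Suc j - i) u))"
    using left_apply[where n = "Suc j" and x = u] by (simp add: algebra_simps)
  \<comment> \<open>The order \<open>Suc (Suc j)\<close> exceeds 1, so no identity term appears, and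
    the last summand contains \<open>a 0 k = 0\<close>.\<close>
  moreover have "b (Suc j) (a 1 k) = - (\<Sum>i\<le>j. b i (a (Suc (Suc j) - i) k))"
    using left_apply[where n = "Suc (Suc j)" and x = k] k
    by (simp add: blinfun.zero_right eq_neg_iff_add_eq_0 add.commute)
  ultimately have "b (Suc j) x = (if j = 0 then u else 0) - (\<Sum>i\<le>j. b i (a (Suc j - i) u))
      - (\<Sum>i\<le>j. b i (a (Suc (Suc j) - i) k))"
    by (subst x) (simp add: blinfun.add_right)
  then show ?thesis
    unfolding k_def[symmetric] u_def[symmetric]
    by (simp add: blinfun.diff_left blinfun.sum_left)
qed

end

end


section \<open>Pencils with an isolated spectral point\<close>

text \<open>Two-sided inverses are unique by \<open>S' = S' T S = S\<close>, so the definite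
  description denotes the inverse.\<close>

lemma op_inverse:
  assumes "op_invertible T"
  shows "op_inverse T \<in> cblinear" "op_inverse T o\<^sub>L T = id_blinfun" "T o\<^sub>L op_inverse T = id_blinfun"
proof -
  let ?P = "\<lambda>S. S \<in> cblinear \<and> S o\<^sub>L T = id_blinfun \<and> T o\<^sub>L S = id_blinfun"
  obtain S where S: "?P S"
    using assms by (auto simp: op_invertible_def)
  have "S' = S" if "?P S'" for S'
  proof (rule blinfun_eqI)
    fix x
    have "S' x = S' ((T o\<^sub>L S) x)" using S by simp
    also have "\<dots> = (S' o\<^sub>L T) (S x)" by simp
    also have "\<dots> = S x" using that by simp
    finally show "S' x = S x" .
  qed
  then have "?P (op_inverse T)"
    unfolding op_inverse_def by (rule theI[of ?P, OF S])
  then show "op_inverse T \<in> cblinear" "op_inverse T o\<^sub>L T = id_blinfun" "T o\<^sub>L op_inverse T = id_blinfun"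
    by auto
qed

text \<open>
  The expansions of \<open>(z - z0)\<^sup>m A(z)\<^sup>-\<^sup>1 o\<^sub>L A(z)\<close> and of the reverse product are compared with that of
  \<open>(z - z0)\<^sup>m\<close> times the identity.
\<close>

lemma pencil_inverse_expansion:
  fixes A :: "complex \<Rightarrow> 'a::complex_banach \<Rightarrow>\<^sub>L 'a"
  assumes U: "open U" and A: "fredholm_pencil A U"
    and iso: "z0 isolated_in pencil_spectrum A U"
    and a: "has_taylor_series A a z0"
    and N: "has_laurent_series (\<lambda>z. op_inverse (A z)) N m z0"
  shows "inverse_expansion a (\<lambda>i. N (int i - int m)) m"
proof -
  let ?b = "\<lambda>i. N (int i - int m)"
  let ?I = "\<lambda>z. (z - z0) ^ m *\<^sub>C op_inverse (A z)"
  let ?id = "id_blinfun :: 'a \<Rightarrow>\<^sub>L 'a"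
  have "z0 \<in> U"
    using iso by (auto simp: isolated_in_islimpt_iff pencil_spectrum_def)
  then have evU: "\<forall>\<^sub>F z in at z0. z \<in> U"
    using U by (intro eventually_at_in_open')
  have "\<forall>\<^sub>F z in at z0. z \<notin> pencil_spectrum A U"
    using iso by (simp add: isolated_in_islimpt_iff islimpt_iff_eventually)
  then have evinv: "\<forall>\<^sub>F z in at z0. op_invertible (A z)"
    using evU by eventually_elim (simp add: pencil_spectrum_def)
  have expA: "has_expansion A a z0"
    using a[unfolded has_taylor_series_def]
    by (intro sums_imp_has_expansion) (simp add: eventually_nhds_conv_at)
  \<comment> \<open>Multiplication by \<open>(z - z0) ^ m\<close> turns the Laurent series into a
    power series away from \<open>z0\<close>.\<close>
  have expI: "has_expansion ?I ?b z0"
  proof (rule sums_imp_has_expansion)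
    show "\<forall>\<^sub>F z in at z0. (\<lambda>j. (z - z0) ^ j *\<^sub>C ?b j) sums ?I z"
      using N[unfolded has_laurent_series_def] eventually_at_neq
    proof eventually_elim
      case (elim z)
      have "(z - z0) ^ m *\<^sub>C (z - z0) powi (int k - int m) *\<^sub>C ?b k = (z - z0) ^ k *\<^sub>C ?b k" for k
        using elim(2) by (simp add: scaleC_scaleC power_int_diff)
      then show ?case
        using bounded_linear.sums[OF bounded_linear_scaleC elim(1), of "(z - z0) ^ m"]
        by (simp only:)
    qed
  qed
  have exp_id: "has_expansion (\<lambda>z. (z - z0) ^ m *\<^sub>C ?id) (\<lambda>n. if n = m then ?id else 0) z0"
  proof (intro sums_imp_has_expansion always_eventually allI)
    fix z
    have "(\<lambda>j. if j = m then (z - z0) ^ j *\<^sub>C ?id else 0) sums ((z - z0) ^ m *\<^sub>C ?id)"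
      by (rule sums_single)
    then show "(\<lambda>j. (z - z0) ^ j *\<^sub>C (if j = m then ?id else 0)) sums ((z - z0) ^ m *\<^sub>C ?id)"
      by (rule back_subst[of "\<lambda>f. f sums _"]) auto
  qed
  have evA: "\<forall>\<^sub>F z in at z0. A z \<in> cblinear"
    using evU by eventually_elim (use A in \<open>simp add: fredholm_pencil_def fredholm_def\<close>)
  have evI: "\<forall>\<^sub>F z in at z0. ?I z \<in> cblinear"
    using evinv
    by eventually_elim (rule complex_vector.subspace_scale[OF subspace_cblinear op_inverse(1)])
  have cb_a: "a j \<in> cblinear" for j
    by (rule has_expansion_in_closed_subspace[OF expA subspace_cblinear closed_cblinear evA])
  have cb_b: "?b j \<in> cblinear" for j
    by (rule has_expansion_in_closed_subspace[OF expI subspace_cblinear closed_cblinear evI])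
  have prods: "\<forall>\<^sub>F z in at z0. (?I z o\<^sub>L A z) = (z - z0) ^ m *\<^sub>C ?id"
    "\<forall>\<^sub>F z in at z0. (A z o\<^sub>L ?I z) = (z - z0) ^ m *\<^sub>C ?id"
  proof -
    have 1: "(c *\<^sub>C op_inverse T) o\<^sub>L T = c *\<^sub>C ?id" if "op_invertible T" for c and T :: "'a \<Rightarrow>\<^sub>L 'a"
    proof (rule blinfun_eqI)
      fix x show "((c *\<^sub>C op_inverse T) o\<^sub>L T) x = (c *\<^sub>C ?id) x"
        using arg_cong[OF op_inverse(2)[OF that], of "\<lambda>S. blinfun_apply S x"]
        by (simp add: scaleC_blinfun.rep_eq)
    qed
    have 2: "T o\<^sub>L (c *\<^sub>C op_inverse T) = c *\<^sub>C ?id" if "op_invertible T" "T \<in> cblinear"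
      for c and T :: "'a \<Rightarrow>\<^sub>L 'a"
    proof (rule blinfun_eqI)
      fix x show "(T o\<^sub>L (c *\<^sub>C op_inverse T)) x = (c *\<^sub>C ?id) x"
        using arg_cong[OF op_inverse(3)[OF that(1)], of "\<lambda>S. blinfun_apply S x"] that(2)
        by (simp add: scaleC_blinfun.rep_eq cblinear_def)
    qed
    show "\<forall>\<^sub>F z in at z0. (?I z o\<^sub>L A z) = (z - z0) ^ m *\<^sub>C ?id"
      using evinv by eventually_elim (rule 1)
    show "\<forall>\<^sub>F z in at z0. (A z o\<^sub>L ?I z) = (z - z0) ^ m *\<^sub>C ?id"
      using evinv evA by eventually_elim (rule 2)
  qed
  show ?thesis
  proof
    show "(\<Sum>i\<le>n. ?b i o\<^sub>L a (n - i)) = (if n = m then id_blinfun else 0)" for n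
      by (rule has_expansion_unique[OF has_expansion_compose[OF expI cb_b expA] exp_id prods(1)])
    show "(\<Sum>i\<le>n. a i o\<^sub>L ?b (n - i)) = (if n = m then id_blinfun else 0)" for n
      by (rule has_expansion_unique[OF has_expansion_compose[OF expA cb_a expI] exp_id prods(2)])
  qed (rule cb_a cb_b)+
qed

text \<open>Substitution of \<open>k = int i - 1\<close>; since \<open>i \<le> j\<close>, the
  subtraction on naturals does not truncate.\<close>

lemma G_sum_order_one:
  "G_sum a N j l 1 = (\<Sum>i\<le>j. N (int i - 1) o\<^sub>L a (Suc j + l - i))"
  unfolding G_sum_def
  by (rule sum.reindex_bij_witness[of _ "\<lambda>i. int i - 1" "\<lambda>k. nat (k + 1)"])
    (auto intro!: arg_cong[where f = a] arg_cong2[where f = "(o\<^sub>L)"] simp: nat_eq_iff)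

theorem proposition3p1:
  fixes A :: "complex \<Rightarrow> 'a::complex_banach \<Rightarrow>\<^sub>L 'a"
    and U :: "complex set" and z0 :: complex
    and a :: "nat \<Rightarrow> 'a \<Rightarrow>\<^sub>L 'a" and N :: "int \<Rightarrow> 'a \<Rightarrow>\<^sub>L 'a" and m :: nat
  assumes "separable_space (euclidean :: 'a topology)"
    and "open U" and "connected U"
    and "fredholm_pencil A U"
    and "z0 isolated_in pencil_spectrum A U"
    and "has_taylor_series A a z0"
    and "1 \<le> m" and "N (- int m) \<noteq> 0"
    and "has_laurent_series (\<lambda>z. op_inverse (A z)) N m z0"
  shows
    "(m = 1 \<longleftrightarrow> direct_sum (op_ran (a 0)) (blinfun_apply (a 1) ` op_ker (a 0))) \<and>
     (m = 1 \<longleftrightarrow> (\<forall>Rc. direct_sum (op_ran (a 0)) Rc \<longrightarrow>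
                    invertible_between (op_ker (a 0)) Rc (S_map a Rc))) \<and>
     (m = 1 \<longleftrightarrow> (\<exists>Rc. direct_sum (op_ran (a 0)) Rc \<and>
                    invertible_between (op_ker (a 0)) Rc (S_map a Rc))) \<and>
     (m = 1 \<longrightarrow>
        (\<forall>Rc Kc. direct_sum (op_ran (a 0)) Rc \<longrightarrow> direct_sum (op_ker (a 0)) Kc \<longrightarrow>
           blinfun_apply (N (-1)) = (\<lambda>x. S_inv a Rc (proj_onto Rc (op_ran (a 0)) x)) \<and>
           (\<forall>j::nat. blinfun_apply (N (int j)) =
              (\<lambda>x. blinfun_apply ((if j = 0 then id_blinfun else 0) - G_sum a N j 0 1)
                     (gen_inverse (a 0) Rc Kc
                        (x - blinfun_apply (a 1) (S_inv a Rc (proj_onto Rc (op_ran (a 0)) x))))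
                   - blinfun_apply (G_sum a N j 1 1)
                       (S_inv a Rc (proj_onto Rc (op_ran (a 0)) x))))))"
proof -
  interpret inverse_expansion a "\<lambda>i. N (int i - int m)" m
    using assms(2,4,5,6,9) by (rule pencil_inverse_expansion)
  have b0: "N (int 0 - int m) \<noteq> 0"
    using assms(8) by simp
  \<comment> \<open>The Taylor series is summed at \<open>z0\<close> itself, where
    \<open>0 ^ 0 = 1\<close> leaves only \<open>a 0\<close>; thus \<open>a 0\<close> inherits the
    Fredholm property from \<open>A z0\<close>.\<close>
  have "A z0 = a 0"
  proof -
    have "(\<lambda>j. 0 ^ j *\<^sub>C a j) sums A z0"
      using eventually_nhds_x_imp_x[OF assms(6)[unfolded has_taylor_series_def]] by simp
    moreover have "(\<lambda>j. 0 ^ j *\<^sub>C a j) = (\<lambda>j. if j = 0 then a j else 0)"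
      by (auto simp: scaleC_one)
    ultimately have "(\<lambda>j. if j = 0 then a j else 0) sums A z0"
      by simp
    then show ?thesis
      by (rule sums_unique2) (rule sums_single)
  qed
  moreover have "z0 \<in> U"
    using assms(5) by (auto simp: isolated_in_islimpt_iff pencil_spectrum_def)
  ultimately have quot: "finite_dim_quotient (op_ran (a 0))"
    using assms(4) by (auto simp: fredholm_pencil_def fredholm_def)
  have simple: "simple_pole_expansion a (\<lambda>i. N (int i - 1))" if "m = 1"
    using inverse_expansion_axioms that by (simp add: simple_pole_expansion_def)
  have ii: "m = 1 \<longleftrightarrow> direct_sum (op_ran (a 0)) (a 1 ` op_ker (a 0))"
    using simple_pole_expansion.direct_sum_a1_ker[OF simple]
      order_one_if_a1_ker_complement[OF assms(7) b0] by blast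
  have inv: "invertible_between (op_ker (a 0)) Rc (S_map a Rc)"
    if "m = 1" "direct_sum (op_ran (a 0)) Rc" for Rc
    using simple_pole_expansion.invertible_between_S_map[OF simple] that by blast
  have order_one: "m = 1" if "direct_sum (op_ran (a 0)) Rc"
    "invertible_between (op_ker (a 0)) Rc (S_map a Rc)" for Rc
    using order_one_if_S_map_invertible[OF assms(7) b0 that] .
  have recursion: "blinfun_apply (N (-1)) = (\<lambda>x. S_inv a Rc (proj_onto Rc (op_ran (a 0)) x)) \<and>
      (\<forall>j::nat. blinfun_apply (N (int j)) =
         (\<lambda>x. blinfun_apply ((if j = 0 then id_blinfun else 0) - G_sum a N j 0 1)
                (gen_inverse (a 0) Rc Kc
                   (x - blinfun_apply (a 1) (S_inv a Rc (proj_onto Rc (op_ran (a 0)) x))))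
              - blinfun_apply (G_sum a N j 1 1)
                  (S_inv a Rc (proj_onto Rc (op_ran (a 0)) x))))"
    if "m = 1" and Rc: "direct_sum (op_ran (a 0)) Rc" and Kc: "direct_sum (op_ker (a 0)) Kc"
    for Rc Kc
  proof -
    interpret simple: simple_pole_expansion a "\<lambda>i. N (int i - 1)"
      by (rule simple[OF \<open>m = 1\<close>])
    have G: "G_sum a N j 0 1 = (\<Sum>i\<le>j. N (int i - 1) o\<^sub>L a (Suc j - i))"
      "G_sum a N j 1 1 = (\<Sum>i\<le>j. N (int i - 1) o\<^sub>L a (Suc (Suc j) - i))" for j
      using G_sum_order_one[of a N j 0] G_sum_order_one[of a N j 1]
      by (simp_all only: add_0_right add_Suc add_Suc_right One_nat_def)
    \<comment> \<open>Turns \<open>b (Suc j)\<close> of the recursion, that is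
      \<open>N (int (Suc j) - 1)\<close>, into \<open>N (int j)\<close>.\<close>
    have index: "int (Suc j) - 1 = int j" for j by simp
    show ?thesis
      unfolding simple.S_inv_proj_onto[OF Rc] G
    proof (intro conjI allI ext)
      show "N (-1) x = N (int 0 - 1) x" for x by simp
    qed (rule simple.b_Suc_recursion[OF Rc Kc, unfolded index])
  qed
  \<comment> \<open>A complement to which (iii) can be applied, so that it yields (iv) and hence
    \<open>m = 1\<close>.\<close>
  obtain Rc where Rc: "direct_sum (op_ran (a 0)) Rc"
    using ex_complement[OF quot] by blast
  show ?thesis
  proof (intro conjI)
    show "m = 1 \<longleftrightarrow> direct_sum (op_ran (a 0)) (a 1 ` op_ker (a 0))"
      by (rule ii)
    show "m = 1 \<longleftrightarrow> (\<forall>Rc. direct_sum (op_ran (a 0)) Rc \<longrightarrow>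
        invertible_between (op_ker (a 0)) Rc (S_map a Rc))"
      using inv order_one Rc by metis
    show "m = 1 \<longleftrightarrow> (\<exists>Rc. direct_sum (op_ran (a 0)) Rc \<and>
        invertible_between (op_ker (a 0)) Rc (S_map a Rc))"
      using inv order_one Rc by metis
  qed (intro impI allI, rule recursion)
qed

end
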